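(* The mixing time of the logit dynamics for the XOR game is $\mathcal{O}(n^3e^\beta)$: there exists a constant $K>0$ such that for every $n\ge 1$ and every $\beta\ge 0$, the mixing time $t_{\mathrm{mix}}$ of the logit dynamics with inverse noise $\beta$ for the $n$-player XOR game satisfies $t_{\mathrm{mix}}\le K n^3e^{\beta}$.
   Context: XOR game: $n$ players, each with strategy set $\{0,1\}$; for every player $i$, $u_i(\mathbf{x})=-1$ if $\mathbf{x}$ has an odd number of $1$'s and $u_i(\mathbf{x})=0$ if $\mathbf{x}$ has an even number of $1$'s. Logit dynamics: for a strategic game with $n$ players, finite strategy sets $S_i$ and utilities $u_i:\prod_j S_j\to\mathbb{R}$, and for $\beta\ge 0$, let $\sigma_i(y\mid\mathbf{x})=e^{\beta u_i(\mathbf{x}_{-i},y)}/\sum_{z\in S_i}e^{\beta u_i(\mathbf{x}_{-i},z)}$, where $(\mathbf{x}_{-i},y)$ is $\mathbf{x}$ with its $i$-th entry replaced by $y$. The logit dynamics with inverse noise $\beta$ is the Markov chain on $\Omega=\prod_j S_j$ which, from profile $\mathbf{x}$, selects a player $i$ uniformly at random and replaces $x_i$ by $y\in S_i$ with probability $\sigma_i(y\mid\mathbf{x})$. It is irreducible and aperiodic; let $P$ be its transition matrix and $\pi$ its unique stationary distribution. The mixing time is $t_{\mathrm{mix}}=\min\{t\in\mathbb{N}:\max_{\mathbf{x}\in\Omega}\|P^t(\mathbf{x},\cdot)-\pi\|_{\mathrm{TV}}\le 1/4\}$, where $\|\mu-\nu\|_{\mathrm{TV}}=\max_{A\subseteq\Omega}|\mu(A)-\nu(A)|$.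 *)

theory Defs
  imports Complex_Main "HOL-Library.FuncSet"
begin

text \<open>
  A finite Markov chain is given by its finite state space \<open>\<Omega>\<close> and its transition matrix
  \<open>P\<close>, with \<open>P x y\<close> the probability of moving from \<open>x\<close> to \<open>y\<close>. Only the entries with
  \<open>x, y \<in> \<Omega>\<close> matter.
\<close>

fun matrix_power :: "'s set \<Rightarrow> ('s \<Rightarrow> 's \<Rightarrow> real) \<Rightarrow> nat \<Rightarrow> 's \<Rightarrow> 's \<Rightarrow> real" where
  "matrix_power \<Omega> P 0 x y = of_bool (x = y)"
| "matrix_power \<Omega> P (Suc t) x y = (\<Sum>z\<in>\<Omega>. matrix_power \<Omega> P t x z * P z y)"

text \<open>
  The value 0 outside \<open>\<Omega>\<close> is only a normalisation: it makes a stationary distribution that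
  is unique on \<open>\<Omega>\<close> also unique as a function on the whole type.
\<close>

definition is_stationary :: "'s set \<Rightarrow> ('s \<Rightarrow> 's \<Rightarrow> real) \<Rightarrow> ('s \<Rightarrow> real) \<Rightarrow> bool" where
  "is_stationary \<Omega> P \<mu> \<longleftrightarrow>
     (\<forall>x\<in>\<Omega>. 0 \<le> \<mu> x) \<and> (\<Sum>x\<in>\<Omega>. \<mu> x) = 1 \<and>
     (\<forall>y\<in>\<Omega>. (\<Sum>x\<in>\<Omega>. \<mu> x * P x y) = \<mu> y) \<and>
     (\<forall>x. x \<notin> \<Omega> \<longrightarrow> \<mu> x = 0)"

definition stationary_distribution :: "'s set \<Rightarrow> ('s \<Rightarrow> 's \<Rightarrow> real) \<Rightarrow> 's \<Rightarrow> real" where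
  "stationary_distribution \<Omega> P = (THE \<mu>. is_stationary \<Omega> P \<mu>)"

definition tv_distance :: "'s set \<Rightarrow> ('s \<Rightarrow> real) \<Rightarrow> ('s \<Rightarrow> real) \<Rightarrow> real" where
  "tv_distance \<Omega> \<mu> \<nu> = (MAX A\<in>Pow \<Omega>. \<bar>(\<Sum>x\<in>A. \<mu> x) - (\<Sum>x\<in>A. \<nu> x)\<bar>)"

definition mixing_time :: "'s set \<Rightarrow> ('s \<Rightarrow> 's \<Rightarrow> real) \<Rightarrow> nat" where
  "mixing_time \<Omega> P =
     (LEAST t. (MAX x\<in>\<Omega>. tv_distance \<Omega> (matrix_power \<Omega> P t x)
                                        (stationary_distribution \<Omega> P)) \<le> 1/4)"

text \<open>
  A strategic game has players \<open>0, \<dots>, n - 1\<close>, finite nonempty strategy sets \<open>S i\<close> and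
  utilities \<open>u i\<close>. Profiles are extensional functions, so that the profile space
  is finite and is closed under the update \<open>x(i := y)\<close>, which renders \<open>(x\<^sub>-\<^sub>i, y)\<close>.
\<close>

definition profiles :: "nat \<Rightarrow> (nat \<Rightarrow> 'a set) \<Rightarrow> (nat \<Rightarrow> 'a) set" where
  "profiles n S = PiE {..<n} S"

definition logit_update ::
    "(nat \<Rightarrow> 'a set) \<Rightarrow> (nat \<Rightarrow> (nat \<Rightarrow> 'a) \<Rightarrow> real) \<Rightarrow> real \<Rightarrow> nat \<Rightarrow> 'a \<Rightarrow> (nat \<Rightarrow> 'a) \<Rightarrow> real" where
  "logit_update S u \<beta> i y x =
     exp (\<beta> * u i (x(i := y))) / (\<Sum>z\<in>S i. exp (\<beta> * u i (x(i := z))))"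

definition logit_matrix ::
    "nat \<Rightarrow> (nat \<Rightarrow> 'a set) \<Rightarrow> (nat \<Rightarrow> (nat \<Rightarrow> 'a) \<Rightarrow> real) \<Rightarrow> real
      \<Rightarrow> (nat \<Rightarrow> 'a) \<Rightarrow> (nat \<Rightarrow> 'a) \<Rightarrow> real" where
  "logit_matrix n S u \<beta> x x' =
     (\<Sum>i<n. 1 / real n * (\<Sum>y\<in>S i. logit_update S u \<beta> i y x * of_bool (x' = x(i := y))))"

definition logit_mixing_time ::
    "nat \<Rightarrow> (nat \<Rightarrow> 'a set) \<Rightarrow> (nat \<Rightarrow> (nat \<Rightarrow> 'a) \<Rightarrow> real) \<Rightarrow> real \<Rightarrow> nat" where
  "logit_mixing_time n S u \<beta> = mixing_time (profiles n S) (logit_matrix n S u \<beta>)"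

definition xor_strategies :: "nat \<Rightarrow> nat set" where
  "xor_strategies i = {0, 1}"

definition xor_utility :: "nat \<Rightarrow> nat \<Rightarrow> (nat \<Rightarrow> nat) \<Rightarrow> real" where
  "xor_utility n i x = (if odd (card {j. j < n \<and> x j = 1}) then -1 else 0)"

end

theory Submission
  imports Defs
begin

text \<open>
  The transition operator acts on the Walsh characters \<open>\<chi>\<^sub>S(x) = \<Prod>\<^sub>j\<^sub>\<in>\<^sub>S (-1)\<^bsup>x j\<^esup>\<close> by
  \<open>P \<chi>\<^sub>S = (1 - k/n) \<chi>\<^sub>S + d (k/n) \<chi>\<^bsub>[n]-S\<^esub>\<close>, where \<open>k = |S|\<close> and \<open>d = tanh (\<beta>/2)\<close>. Hence each
  plane spanned by \<open>\<chi>\<^sub>S\<close> and \<open>\<chi>\<^bsub>[n]-S\<^esub>\<close> is invariant, and for \<open>S \<noteq> {}, [n]\<close> the sum of the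
  absolute values of the two coefficients contracts by \<open>1 - (1 - d)/n\<close> in each step, where
  \<open>1 - d \<ge> exp (-\<beta>)\<close>. Only \<open>\<chi>\<^bsub>{}\<^esub>\<close> and \<open>P \<chi>\<^bsub>[n]\<^esub> = d\<close> survive in the limit, which is
  therefore \<open>2\<^bsup>-n\<^esup> (1 + d \<chi>\<^bsub>[n]\<^esub>)\<close>; expanding a point mass in characters bounds the pointwise error
  after \<open>t\<close> steps by \<open>(1 - exp (-\<beta>)/n)\<^bsup>t\<^esup>\<close>, and \<open>n (n + 2) exp \<beta>\<close> steps suffice.
\<close>

section \<open>Finite Markov chains\<close>

lemma matrix_power_sum_eq_1:
  assumes "\<And>x. x \<in> \<Omega> \<Longrightarrow> (\<Sum>y\<in>\<Omega>. P x y) = 1" "finite \<Omega>" "x \<in> \<Omega>"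
  shows "(\<Sum>y\<in>\<Omega>. matrix_power \<Omega> P t x y) = 1"
proof (induction t)
  case 0
  show ?case using assms by (simp add: of_bool_def)
next
  case (Suc t)
  have "(\<Sum>y\<in>\<Omega>. matrix_power \<Omega> P (Suc t) x y)
      = (\<Sum>z\<in>\<Omega>. \<Sum>y\<in>\<Omega>. matrix_power \<Omega> P t x z * P z y)"
    unfolding matrix_power.simps by (rule sum.swap)
  also have "\<dots> = (\<Sum>z\<in>\<Omega>. matrix_power \<Omega> P t x z)"
    by (intro sum.cong refl) (simp add: assms flip: sum_distrib_left)
  finally show ?case using Suc by simp
qed

text \<open>Since \<open>matrix_power\<close> appends its new factor on the right, \<open>P\<close>
  acts first on the test function. Inductions on \<open>t\<close> can thus keep the starting state
  \<open>x\<close> fixed and let \<open>f\<close> vary.\<close>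

lemma matrix_power_Suc_apply:
  "(\<Sum>y\<in>\<Omega>. matrix_power \<Omega> P (Suc t) x y * f y)
     = (\<Sum>z\<in>\<Omega>. matrix_power \<Omega> P t x z * (\<Sum>y\<in>\<Omega>. P z y * f y))"
proof -
  have "(\<Sum>y\<in>\<Omega>. matrix_power \<Omega> P (Suc t) x y * f y)
      = (\<Sum>y\<in>\<Omega>. \<Sum>z\<in>\<Omega>. matrix_power \<Omega> P t x z * (P z y * f y))"
    by (simp add: sum_distrib_right mult.assoc)
  also have "\<dots> = (\<Sum>z\<in>\<Omega>. \<Sum>y\<in>\<Omega>. matrix_power \<Omega> P t x z * (P z y * f y))"
    by (rule sum.swap)
  finally show ?thesis by (simp add: sum_distrib_left)
qed

lemma is_stationary_matrix_power:
  assumes "is_stationary \<Omega> P \<mu>" "finite \<Omega>" "y \<in> \<Omega>"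
  shows "(\<Sum>x\<in>\<Omega>. \<mu> x * matrix_power \<Omega> P t x y) = \<mu> y"
  using assms(3)
proof (induction t arbitrary: y)
  case 0
  then show ?case using assms by (simp add: of_bool_def if_distrib cong: if_cong)
next
  case (Suc t)
  have "(\<Sum>x\<in>\<Omega>. \<mu> x * matrix_power \<Omega> P (Suc t) x y)
      = (\<Sum>x\<in>\<Omega>. \<Sum>z\<in>\<Omega>. \<mu> x * matrix_power \<Omega> P t x z * P z y)"
    by (simp add: sum_distrib_left mult.assoc)
  also have "\<dots> = (\<Sum>z\<in>\<Omega>. (\<Sum>x\<in>\<Omega>. \<mu> x * matrix_power \<Omega> P t x z) * P z y)"
    by (subst sum.swap) (simp add: sum_distrib_right)
  also have "\<dots> = (\<Sum>z\<in>\<Omega>. \<mu> z * P z y)"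
    by (simp add: Suc.IH)
  finally show ?case using assms(1) Suc.prems by (simp add: is_stationary_def)
qed

text \<open>Convergence of all rows to one common limit yields both existence and uniqueness:
  stationarity of the limit and its total mass come from passing to the limit in identities that
  hold for every \<open>t\<close>.\<close>

lemma stationary_distribution_eqI:
  assumes fin: "finite \<Omega>" and "\<Omega> \<noteq> {}"
    and rows: "\<And>x. x \<in> \<Omega> \<Longrightarrow> (\<Sum>y\<in>\<Omega>. P x y) = 1"
    and lim: "\<And>x y. x \<in> \<Omega> \<Longrightarrow> y \<in> \<Omega> \<Longrightarrow> (\<lambda>t. matrix_power \<Omega> P t x y) \<longlonglongrightarrow> \<pi> y"
    and nonneg: "\<And>x. x \<in> \<Omega> \<Longrightarrow> 0 \<le> \<pi> x"
    and outside: "\<And>x. x \<notin> \<Omega> \<Longrightarrow> \<pi> x = 0"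
  shows "stationary_distribution \<Omega> P = \<pi>"
proof -
  obtain x0 where x0: "x0 \<in> \<Omega>" using \<open>\<Omega> \<noteq> {}\<close> by blast
  have "(\<lambda>t. \<Sum>y\<in>\<Omega>. matrix_power \<Omega> P t x0 y) \<longlonglongrightarrow> (\<Sum>y\<in>\<Omega>. \<pi> y)"
    by (intro tendsto_sum lim x0)
  then have sum1: "(\<Sum>y\<in>\<Omega>. \<pi> y) = 1"
    using matrix_power_sum_eq_1[of \<Omega> P, OF rows fin x0] by (simp add: LIMSEQ_const_iff)
  have bal: "(\<Sum>x\<in>\<Omega>. \<pi> x * P x y) = \<pi> y" if y: "y \<in> \<Omega>" for y
  proof (rule LIMSEQ_unique)
    \<comment> \<open>The same sequence gets two limits, once as a shift and once through the
      recursion for \<open>Suc t\<close>.\<close>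
    show "(\<lambda>t. matrix_power \<Omega> P (Suc t) x0 y) \<longlonglongrightarrow> \<pi> y"
      using lim[OF x0 y] by (rule LIMSEQ_Suc)
    show "(\<lambda>t. matrix_power \<Omega> P (Suc t) x0 y) \<longlonglongrightarrow> (\<Sum>x\<in>\<Omega>. \<pi> x * P x y)"
      unfolding matrix_power.simps by (intro tendsto_intros lim x0)
  qed
  have "\<mu> = \<pi>" if mu: "is_stationary \<Omega> P \<mu>" for \<mu>
  proof
    fix y
    show "\<mu> y = \<pi> y"
    proof (cases "y \<in> \<Omega>")
      case True
      \<comment> \<open>Averaged against \<open>\<mu>\<close>, the rows give a sequence that is
        constantly \<open>\<mu> y\<close>, while its limit is \<open>\<pi> y\<close> times the total
        mass of \<open>\<mu>\<close>.\<close>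
      have "(\<lambda>t. \<Sum>x\<in>\<Omega>. \<mu> x * matrix_power \<Omega> P t x y) \<longlonglongrightarrow> (\<Sum>x\<in>\<Omega>. \<mu> x * \<pi> y)"
        by (intro tendsto_intros lim True)
      then have "(\<lambda>t::nat. \<mu> y) \<longlonglongrightarrow> (\<Sum>x\<in>\<Omega>. \<mu> x) * \<pi> y"
        using is_stationary_matrix_power[OF mu fin True] by (simp add: sum_distrib_right)
      then show ?thesis
        using mu by (simp add: is_stationary_def LIMSEQ_const_iff)
    next
      case False
      then show ?thesis using mu outside by (simp add: is_stationary_def)
    qed
  qed
  moreover have "is_stationary \<Omega> P \<pi>"
    using sum1 bal nonneg outside by (auto simp: is_stationary_def)
  ultimately show ?thesis
    unfolding stationary_distribution_def by blast
qed

text \<open>Every event is bounded by the full l1 distance. The price is the factor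
  \<open>card \<Omega>\<close>, here \<open>2 ^ n\<close>, which the exponential decay has to
  beat.\<close>

lemma tv_distance_le:
  assumes "finite \<Omega>" "\<And>y. y \<in> \<Omega> \<Longrightarrow> \<bar>\<mu> y - \<nu> y\<bar> \<le> e"
  shows "tv_distance \<Omega> \<mu> \<nu> \<le> real (card \<Omega>) * e"
  unfolding tv_distance_def
proof (subst Max_le_iff; (intro ballI)?)
  fix z assume "z \<in> (\<lambda>A. \<bar>(\<Sum>x\<in>A. \<mu> x) - (\<Sum>x\<in>A. \<nu> x)\<bar>) ` Pow \<Omega>"
  then obtain A where A: "A \<subseteq> \<Omega>" and z: "z = \<bar>(\<Sum>x\<in>A. \<mu> x) - (\<Sum>x\<in>A. \<nu> x)\<bar>" by blast
  have "z \<le> (\<Sum>x\<in>A. \<bar>\<mu> x - \<nu> x\<bar>)"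
    unfolding z sum_subtractf[symmetric] by (rule sum_abs)
  also have "\<dots> \<le> (\<Sum>x\<in>\<Omega>. \<bar>\<mu> x - \<nu> x\<bar>)"
    using assms A by (intro sum_mono2) auto
  also have "\<dots> \<le> real (card \<Omega>) * e"
    using assms by (intro sum_bounded_above) auto
  finally show "z \<le> real (card \<Omega>) * e" .
qed (use assms in auto)

lemma mixing_time_le:
  assumes "finite \<Omega>" "\<Omega> \<noteq> {}"
    and "\<And>x y. x \<in> \<Omega> \<Longrightarrow> y \<in> \<Omega> \<Longrightarrow> \<bar>matrix_power \<Omega> P t x y - stationary_distribution \<Omega> P y\<bar> \<le> e"
    and "real (card \<Omega>) * e \<le> 1/4"
  shows "mixing_time \<Omega> P \<le> t"
  unfolding mixing_time_def
proof (rule Least_le)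
  show "(MAX x\<in>\<Omega>. tv_distance \<Omega> (matrix_power \<Omega> P t x) (stationary_distribution \<Omega> P)) \<le> 1/4"
    using assms tv_distance_le[OF assms(1) assms(3)] by (subst Max_le_iff) fastforce+
qed

section \<open>Walsh characters\<close>

definition walsh :: "nat set \<Rightarrow> (nat \<Rightarrow> nat) \<Rightarrow> real" where
  "walsh S x = (\<Prod>j\<in>S. (-1) ^ x j)"

lemma walsh_square: "walsh S x * walsh S x = 1"
  by (simp add: walsh_def flip: prod.distrib power_add)

lemma walsh_cases: "walsh S x = 1 \<or> walsh S x = -1"
  using walsh_square square_eq_1_iff by blast

lemma abs_walsh: "\<bar>walsh S x\<bar> = 1"
  using walsh_cases[of S x] by auto

lemma walsh_upd:
  assumes "finite S" "i \<in> S"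
  shows "walsh S (x(i := y)) = (-1) ^ y * walsh (S - {i}) x"
proof -
  have "walsh S (x(i := y)) = (-1) ^ y * (\<Prod>j\<in>S - {i}. (-1) ^ (x(i := y)) j)"
    using assms by (simp add: walsh_def prod.remove)
  also have "(\<Prod>j\<in>S - {i}. (-1) ^ (x(i := y)) j) = walsh (S - {i}) x"
    unfolding walsh_def by (intro prod.cong) auto
  finally show ?thesis .
qed

lemma walsh_upd_notin: "i \<notin> S \<Longrightarrow> walsh S (x(i := y)) = walsh S x"
  unfolding walsh_def by (intro prod.cong) auto

text \<open>The signs indexed by \<open>S\<close> occur twice and cancel. This is how complementary
  characters enter the dynamics.\<close>

lemma walsh_Diff:
  assumes "finite A" "S \<subseteq> A"
  shows "walsh S x * walsh A x = walsh (A - S) x"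
proof -
  have "walsh A x = walsh (A - S) x * walsh S x"
    unfolding walsh_def by (rule prod.subset_diff) fact+
  then show ?thesis using walsh_square[of S x] by simp
qed

section \<open>The hypercube of profiles and completeness of the characters\<close>

abbreviation xor_profiles :: "nat \<Rightarrow> (nat \<Rightarrow> nat) set" where
  "xor_profiles n \<equiv> profiles n xor_strategies"

lemma finite_xor_profiles: "finite (xor_profiles n)"
  unfolding profiles_def xor_strategies_def by (intro finite_PiE) auto

lemma card_xor_profiles: "card (xor_profiles n) = 2 ^ n"
  unfolding profiles_def xor_strategies_def by (subst card_PiE) (auto simp: numeral_2_eq_2)

lemma xor_profiles_nonempty: "xor_profiles n \<noteq> {}"
  using card_xor_profiles[of n] by fastforce

text \<open>The sum over all subsets is the expansion of a product over coordinates. Its factors are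
  2 where \<open>x\<close> and \<open>y\<close> agree and 0 where they differ. The relation expands
  a point mass in characters.\<close>

lemma sum_walsh_mult:
  assumes "x \<in> xor_profiles n" "y \<in> xor_profiles n"
  shows "(\<Sum>S\<in>Pow {..<n}. walsh S x * walsh S y) = 2 ^ n * of_bool (x = y)"
proof -
  have "(\<Sum>S\<in>Pow {..<n}. walsh S x * walsh S y) = (\<Prod>j<n. (-1) ^ x j * (-1) ^ y j + 1)"
    by (subst prod_add) (auto simp: walsh_def prod.distrib)
  also have "\<dots> = 2 ^ n * of_bool (x = y)"
  proof (cases "x = y")
    case True
    then show ?thesis by (simp flip: power_add)
  next
    case False
    then obtain j where j: "j < n" "x j \<noteq> y j"
      using assms PiE_ext unfolding profiles_def by (metis lessThan_iff)
    have "x j \<in> {0, 1}" "y j \<in> {0, 1}"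
      using assms j(1) by (auto simp: profiles_def xor_strategies_def PiE_iff)
    then have "(-1) ^ x j * (-1) ^ y j + 1 = (0::real)"
      using j(2) by auto
    then show ?thesis using False j by (subst prod_zero) auto
  qed
  finally show ?thesis .
qed

section \<open>The logit dynamics of the XOR game\<close>

text \<open>After swapping the sums, the indicator selects the single term
  \<open>x' = x(i := y)\<close>, which lies in the profile space.\<close>

lemma logit_matrix_apply:
  assumes "\<And>i. finite (S i)" "x \<in> profiles n S"
  shows "(\<Sum>x'\<in>profiles n S. logit_matrix n S u \<beta> x x' * f x')
    = (\<Sum>i<n. 1 / real n * (\<Sum>y\<in>S i. logit_update S u \<beta> i y x * f (x(i := y))))"
proof -
  have fin: "finite (profiles n S)"
    using assms unfolding profiles_def by (intro finite_PiE) auto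
  have upd: "x(i := y) \<in> profiles n S" if "i < n" "y \<in> S i" for i y
    using assms that by (auto simp: profiles_def PiE_iff extensional_def)
  have "(\<Sum>x'\<in>profiles n S. logit_matrix n S u \<beta> x x' * f x')
    = (\<Sum>x'\<in>profiles n S. \<Sum>i<n. \<Sum>y\<in>S i.
         1 / real n * (logit_update S u \<beta> i y x * (of_bool (x' = x(i := y)) * f x')))"
    by (simp add: logit_matrix_def sum_distrib_left sum_distrib_right mult.assoc)
  also have "\<dots> = (\<Sum>i<n. \<Sum>y\<in>S i. \<Sum>x'\<in>profiles n S.
         1 / real n * (logit_update S u \<beta> i y x * (of_bool (x' = x(i := y)) * f x')))"
    by (subst sum.swap) (simp add: sum.swap[of _ "profiles n S"])
  also have "\<dots> = (\<Sum>i<n. \<Sum>y\<in>S i. 1 / real n * (logit_update S u \<beta> i y x * f (x(i := y))))"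
    using fin upd by (intro sum.cong refl) (simp add: of_bool_def if_distrib if_distribR 
        sum.If_cases flip: sum_distrib_left cong: if_cong)
  finally show ?thesis by (simp add: sum_distrib_left)
qed

text \<open>The full character is the parity sign, and the affine map here sends 1 to 0 and -1 to
  -1.\<close>

lemma xor_utility_eq_walsh:
  assumes "x \<in> xor_profiles n"
  shows "xor_utility n i x = (walsh {..<n} x - 1) / 2"
proof -
  have "walsh {..<n} x = (\<Prod>j<n. if x j = 1 then -1 else 1)"
    unfolding walsh_def using assms
    by (intro prod.cong) (force simp: profiles_def xor_strategies_def PiE_iff)+
  also have "\<dots> = (-1) ^ card {j. j < n \<and> x j = 1}"
    by (simp add: prod.If_cases Int_def)
  finally show ?thesis
    by (simp add: xor_utility_def minus_one_power_iff)
qed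

section \<open>The update of a single player acting on characters\<close>

lemma exp_div_exp_add: "exp a / (exp a + exp b) = 1 / (1 + exp (b - a))" for a b :: real
proof -
  have "exp a + exp b = exp a * (1 + exp (b - a))"
    by (simp add: distrib_left flip: exp_add)
  then show ?thesis by simp
qed

text \<open>For \<open>i \<notin> S\<close> the character does not see the update and the
  probabilities add up to 1. For \<open>i \<in> S\<close> the mean of the new sign is
  \<open>e * tanh (\<beta> / 2)\<close>, where \<open>e\<close> is the parity sign of the other
  players; multiplying \<open>e\<close> by the character of \<open>S - {i}\<close> leaves that of
  the complement of \<open>S\<close>.\<close>

lemma logit_update_xor_walsh:
  assumes x: "x \<in> xor_profiles n" and i: "i < n" and S: "S \<subseteq> {..<n}"
  shows "(\<Sum>y\<in>xor_strategies i.
            logit_update xor_strategies (xor_utility n) \<beta> i y x * walsh S (x(i := y)))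
     = (if i \<in> S then tanh (\<beta> / 2) * walsh ({..<n} - S) x else walsh S x)"
proof -
  define e where "e = walsh ({..<n} - {i}) x"
  have e: "e = 1 \<or> e = -1" unfolding e_def by (rule walsh_cases)
  have "x(i := y) \<in> xor_profiles n" if "y \<in> {0, 1}" for y
    using x i that by (auto simp: profiles_def PiE_iff extensional_def xor_strategies_def)
  then have u: "xor_utility n i (x(i := y)) = ((-1) ^ y * e - 1) / 2" if "y \<in> {0, 1}" for y
    using that i by (simp add: xor_utility_eq_walsh walsh_upd e_def)
  define s where "s y = logit_update xor_strategies (xor_utility n) \<beta> i y x" for y
  have u01: "xor_utility n i (x(i := 0)) = (e - 1) / 2" "xor_utility n i (x(i := Suc 0)) = (- e - 1) / 2"
    using u[of 0] u[of 1] by simp_all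
  have s0: "s 0 = 1 / (1 + exp (- \<beta> * e))" and s1: "s 1 = 1 / (1 + exp (\<beta> * e))"
  proof -
    have diff: "\<beta> * ((- e - 1) / 2) - \<beta> * ((e - 1) / 2) = - \<beta> * e"
      "\<beta> * ((e - 1) / 2) - \<beta> * ((- e - 1) / 2) = \<beta> * e"
      by (simp_all add: field_simps)
    have sum: "(\<Sum>z\<in>xor_strategies i. exp (\<beta> * xor_utility n i (x(i := z))))
      = exp (\<beta> * ((e - 1) / 2)) + exp (\<beta> * ((- e - 1) / 2))"
      by (simp add: xor_strategies_def u01)
    show "s 0 = 1 / (1 + exp (- \<beta> * e))"
      unfolding s_def logit_update_def sum u01 exp_div_exp_add diff ..
    show "s 1 = 1 / (1 + exp (\<beta> * e))"
      unfolding s_def logit_update_def sum One_nat_def u01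
      by (subst add.commute) (simp only: exp_div_exp_add diff)
  qed
  have E: "1 / (1 + exp (- \<beta>)) = exp \<beta> / (1 + exp \<beta>)" "1 + exp \<beta> \<noteq> 0"
    using exp_div_exp_add[of \<beta> 0] exp_gt_zero[of \<beta>] by (auto simp: add.commute simp del: exp_gt_zero)
  have "exp \<beta> / (1 + exp \<beta>) + 1 / (1 + exp \<beta>) = 1"
    using E(2) by (simp add: add.commute flip: add_divide_distrib)
  then have s_add: "s 0 + s 1 = 1"
    using e unfolding s0 s1 by (auto simp: E(1))
  \<comment> \<open>Writing \<open>1 / (1 + exp \<beta>)\<close> as
    \<open>exp (- \<beta>) / (1 + exp (- \<beta>))\<close> brings the difference into the form
    \<open>(1 - exp (- \<beta>)) / (1 + exp (- \<beta>))\<close> of the hyperbolic tangent. The sign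
    \<open>e\<close> only exchanges the two probabilities.\<close>
  have s_diff: "s 0 - s 1 = e * tanh (\<beta> / 2)"
    using e exp_div_exp_add[of "- \<beta>" 0] unfolding s0 s1 tanh_real_altdef
    by (auto simp: diff_divide_distrib add.commute)
  have "finite S" using S finite_subset by blast
  have "(\<Sum>y\<in>xor_strategies i. s y * walsh S (x(i := y)))
      = s 0 * walsh S (x(i := 0)) + s 1 * walsh S (x(i := 1))"
    by (simp add: xor_strategies_def)
  also have "\<dots> = (if i \<in> S then tanh (\<beta> / 2) * walsh ({..<n} - S) x else walsh S x)"
  proof (cases "i \<in> S")
    case True
    have "({..<n} - {i}) - (S - {i}) = {..<n} - S" using True by auto
    then have walsh: "walsh (S - {i}) x * e = walsh ({..<n} - S) x"
      unfolding e_def using S by (subst walsh_Diff) auto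
    have "s 0 * walsh S (x(i := 0)) + s 1 * walsh S (x(i := 1)) = (s 0 - s 1) * walsh (S - {i}) x"
      using \<open>finite S\<close> True by (simp add: walsh_upd left_diff_distrib)
    also have "\<dots> = tanh (\<beta> / 2) * (walsh (S - {i}) x * e)"
      unfolding s_diff by (simp add: mult_ac)
    finally show ?thesis using True by (simp add: walsh)
  next
    case False
    then show ?thesis using s_add by (simp add: walsh_upd_notin flip: distrib_right)
  qed
  finally show ?thesis unfolding s_def .
qed

section \<open>Contraction of the chain and convergence to its stationary distribution\<close>

context
  fixes n :: nat and \<beta> :: real
  assumes n: "n \<ge> 1" and beta: "\<beta> \<ge> 0"
begin

abbreviation "xor_matrix \<equiv> logit_matrix n xor_strategies (xor_utility n) \<beta>"

abbreviation "xor_power \<equiv> matrix_power (xor_profiles n) xor_matrix"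

text \<open>The probability that an update ends in even parity minus the probability that it ends in
  odd parity.\<close>

definition "drift = tanh (\<beta> / 2)"

text \<open>The largest value of \<open>1 - (1 - drift) * k / n\<close> over
  \<open>1 \<le> k \<le> n - 1\<close>, attained at \<open>k = 1\<close> when
  \<open>n \<ge> 2\<close>.\<close>

definition "xor_rate = 1 - (1 - drift) / real n"

text \<open>This is the Gibbs distribution of the common utility, since
  \<open>(1 - drift) / (1 + drift) = exp (- \<beta>)\<close>. The value 0 outside matches the
  normalisation in \<open>is_stationary\<close>.\<close>

definition "xor_stationary x =
  (if x \<in> xor_profiles n then (1 + drift * walsh {..<n} x) / 2 ^ n else 0)"

lemma drift_nonneg: "0 \<le> drift"
  using beta by (simp add: drift_def)

lemma drift_less_1: "drift < 1"
  by (simp add: drift_def tanh_real_lt_1)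

text \<open>\<open>1 - drift\<close> equals \<open>2 / (exp \<beta> + 1)\<close>, and
  \<open>exp \<beta> \<ge> 1\<close>. This is the source of the factor \<open>exp \<beta>\<close> in
  the mixing time.\<close>

lemma one_minus_drift_ge: "exp (- \<beta>) \<le> 1 - drift"
proof -
  have "exp (- \<beta>) \<le> 1" using beta by simp
  then have "exp (- \<beta>) * (1 + exp (- \<beta>)) \<le> exp (- \<beta>) * 2"
    by (intro mult_left_mono) auto
  moreover have "1 - drift = 2 * exp (- \<beta>) / (1 + exp (- \<beta>))"
  proof -
    have "1 + exp (- \<beta>) \<noteq> 0"
      using exp_gt_zero[of "- \<beta>"] by linarith
    then show ?thesis
      unfolding drift_def tanh_real_altdef by (simp add: divide_simps)
  qed
  ultimately show ?thesis
    by (simp add: pos_le_divide_eq add_pos_pos mult.commute)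
qed

lemma xor_rate_nonneg: "0 \<le> xor_rate"
  using n drift_nonneg by (simp add: xor_rate_def divide_simps)

lemma xor_rate_less_1: "xor_rate < 1"
  using n drift_less_1 by (simp add: xor_rate_def)

text \<open>Averaging the one-player formula over the players: those in \<open>S\<close> produce the
  complementary character, the others preserve the character.\<close>

lemma xor_matrix_walsh:
  assumes x: "x \<in> xor_profiles n" and S: "S \<subseteq> {..<n}"
  shows "(\<Sum>y\<in>xor_profiles n. xor_matrix x y * walsh S y)
    = (1 - card S / real n) * walsh S x + card S / real n * (drift * walsh ({..<n} - S) x)"
proof -
  have "(\<Sum>y\<in>xor_profiles n. xor_matrix x y * walsh S y)
      = (\<Sum>i<n. 1 / real n * (if i \<in> S then drift * walsh ({..<n} - S) x else walsh S x))"
    unfolding drift_def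
    by (subst logit_matrix_apply[OF _ x], simp add: xor_strategies_def,
        intro sum.cong refl, subst logit_update_xor_walsh[OF x _ S], auto)
  also have "\<dots> = 1 / real n *
      (card S * (drift * walsh ({..<n} - S) x) + card ({..<n} - S) * walsh S x)"
    unfolding sum_distrib_left[symmetric]
    using S by (simp add: sum.If_cases Int_absorb1 flip: Diff_eq)
  also have "real (card ({..<n} - S)) = real n - card S"
    using S card_mono[OF _ S] by (simp add: card_Diff_subset finite_subset of_nat_diff)
  finally show ?thesis using n by (simp add: field_simps)
qed

lemma xor_matrix_row_sum:
  assumes "x \<in> xor_profiles n"
  shows "(\<Sum>y\<in>xor_profiles n. xor_matrix x y) = 1"
  using xor_matrix_walsh[OF assms, of "{}"] by (simp add: walsh_def)

text \<open>The coefficients are arbitrary because one step of the chain changes them within the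
  invariant plane; the induction tracks only the sum of their absolute values.\<close>

lemma xor_power_pair_bound:
  assumes x: "x \<in> xor_profiles n" and S: "S \<subset> {..<n}" "S \<noteq> {}"
  shows "\<bar>\<Sum>y\<in>xor_profiles n. xor_power t x y * (a * walsh S y + b * walsh ({..<n} - S) y)\<bar>
     \<le> xor_rate ^ t * (\<bar>a\<bar> + \<bar>b\<bar>)"
proof (induction t arbitrary: a b)
  case 0
  have "\<bar>a * walsh S x + b * walsh ({..<n} - S) x\<bar> \<le> \<bar>a\<bar> + \<bar>b\<bar>"
    using abs_triangle_ineq[of "a * walsh S x" "b * walsh ({..<n} - S) x"]
    by (simp add: abs_mult abs_walsh)
  moreover have "(\<Sum>y\<in>xor_profiles n. xor_power 0 x y * (a * walsh S y + b * walsh ({..<n} - S) y))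
      = a * walsh S x + b * walsh ({..<n} - S) x"
  proof -
    have "xor_profiles n \<inter> {y. x = y} = {x}" using x by auto
    then show ?thesis by (simp add: sum_of_bool_mult_eq finite_xor_profiles)
  qed
  ultimately show ?case by simp
next
  case (Suc t)
  define k where "k = card S / real n"
  have fS: "finite S" using S finite_subset by blast
  have card: "1 \<le> card S" "card S + 1 \<le> n"
    using S fS psubset_card_mono[of "{..<n}" S] by (auto simp: Suc_le_eq card_gt_0_iff)
  \<comment> \<open>Both \<open>S\<close> and its complement are nonempty, so both fractions are at
    least \<open>1 / n\<close>.\<close>
  have k: "1 / real n \<le> k" "1 / real n \<le> 1 - k" "0 \<le> k" "0 \<le> 1 - k"
    using card by (auto simp: k_def divide_simps)
  have k': "card ({..<n} - S) / real n = 1 - k"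
    using S fS card by (simp add: k_def card_Diff_subset of_nat_diff field_simps)
  define a' where "a' = (1 - k) * (a + drift * b)"
  define b' where "b' = k * (drift * a + b)"
  have step: "(\<Sum>y\<in>xor_profiles n. xor_matrix z y * (a * walsh S y + b * walsh ({..<n} - S) y))
      = a' * walsh S z + b' * walsh ({..<n} - S) z" if z: "z \<in> xor_profiles n" for z
  proof -
    have SS: "{..<n} - ({..<n} - S) = S" using S by blast
    have "(\<Sum>y\<in>xor_profiles n. xor_matrix z y * (a * walsh S y + b * walsh ({..<n} - S) y))
       = a * (\<Sum>y\<in>xor_profiles n. xor_matrix z y * walsh S y)
         + b * (\<Sum>y\<in>xor_profiles n. xor_matrix z y * walsh ({..<n} - S) y)"
      by (simp add: sum_distrib_left sum.distrib algebra_simps)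
    also have "(\<Sum>y\<in>xor_profiles n. xor_matrix z y * walsh S y)
        = (1 - k) * walsh S z + k * (drift * walsh ({..<n} - S) z)"
      unfolding k_def using S by (intro xor_matrix_walsh z) auto
    also have "(\<Sum>y\<in>xor_profiles n. xor_matrix z y * walsh ({..<n} - S) y)
        = k * walsh ({..<n} - S) z + (1 - k) * (drift * walsh S z)"
      using xor_matrix_walsh[OF z, of "{..<n} - S"] unfolding SS k' by simp
    also have "a * ((1 - k) * walsh S z + k * (drift * walsh ({..<n} - S) z))
          + b * (k * walsh ({..<n} - S) z + (1 - k) * (drift * walsh S z))
        = a' * walsh S z + b' * walsh ({..<n} - S) z"
      unfolding a'_def b'_def by (simp add: algebra_simps)
    finally show ?thesis .
  qed
  have "\<bar>a'\<bar> + \<bar>b'\<bar> \<le> (1 - k) * (\<bar>a\<bar> + drift * \<bar>b\<bar>) + k * (drift * \<bar>a\<bar> + \<bar>b\<bar>)"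
  proof -
    have "\<bar>a + drift * b\<bar> \<le> \<bar>a\<bar> + drift * \<bar>b\<bar>" "\<bar>drift * a + b\<bar> \<le> drift * \<bar>a\<bar> + \<bar>b\<bar>"
      using abs_triangle_ineq[of a "drift * b"] abs_triangle_ineq[of "drift * a" b]
      by (simp_all only: abs_mult abs_of_nonneg[OF drift_nonneg])
    then show ?thesis
      unfolding a'_def b'_def abs_mult abs_of_nonneg[OF k(3)] abs_of_nonneg[OF k(4)]
      by (intro add_mono mult_left_mono k)
  qed
  \<comment> \<open>Regrouping by the old coefficients exposes two factors, each at most
    \<open>xor_rate\<close>.\<close>
  also have "\<dots> = (1 - (1 - drift) * k) * \<bar>a\<bar> + (1 - (1 - drift) * (1 - k)) * \<bar>b\<bar>"
    by (simp add: algebra_simps)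
  also have "\<dots> \<le> xor_rate * \<bar>a\<bar> + xor_rate * \<bar>b\<bar>"
    using mult_left_mono[OF k(1), of "1 - drift"] mult_left_mono[OF k(2), of "1 - drift"] drift_less_1
    by (intro add_mono mult_right_mono) (auto simp: xor_rate_def)
  finally have contract: "\<bar>a'\<bar> + \<bar>b'\<bar> \<le> xor_rate * (\<bar>a\<bar> + \<bar>b\<bar>)"
    by (simp add: algebra_simps)
  have "\<bar>\<Sum>y\<in>xor_profiles n. xor_power (Suc t) x y * (a * walsh S y + b * walsh ({..<n} - S) y)\<bar>
      = \<bar>\<Sum>z\<in>xor_profiles n. xor_power t x z * (a' * walsh S z + b' * walsh ({..<n} - S) z)\<bar>"
    unfolding matrix_power_Suc_apply by (simp add: step)
  also have "\<dots> \<le> xor_rate ^ t * (\<bar>a'\<bar> + \<bar>b'\<bar>)"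
    by (rule Suc.IH)
  also have "\<dots> \<le> xor_rate ^ t * (xor_rate * (\<bar>a\<bar> + \<bar>b\<bar>))"
    using contract xor_rate_nonneg by (intro mult_left_mono) auto
  finally show ?case by (simp add: algebra_simps)
qed

text \<open>Every player lies in the full set and its complement is empty, so one step already turns
  the full character into the constant \<open>drift\<close>. At time 0 the value would still be
  \<open>walsh {..<n} x\<close>, hence \<open>Suc t\<close>.\<close>

lemma xor_power_walsh_full:
  assumes x: "x \<in> xor_profiles n"
  shows "(\<Sum>y\<in>xor_profiles n. xor_power (Suc t) x y * walsh {..<n} y) = drift"
proof -
  have "(\<Sum>y\<in>xor_profiles n. xor_matrix z y * walsh {..<n} y) = drift"
    if "z \<in> xor_profiles n" for z
    using xor_matrix_walsh[OF that, of "{..<n}"] n by (simp add: walsh_def)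
  then have "(\<Sum>y\<in>xor_profiles n. xor_power (Suc t) x y * walsh {..<n} y)
      = (\<Sum>z\<in>xor_profiles n. xor_power t x z) * drift"
    unfolding matrix_power_Suc_apply by (simp add: sum_distrib_right)
  then show ?thesis
    using matrix_power_sum_eq_1[of "xor_profiles n" xor_matrix, OF xor_matrix_row_sum finite_xor_profiles x]
    by simp
qed

text \<open>Expanding the point mass at \<open>y\<close> in characters, the empty and full sets
  contribute exactly \<open>xor_stationary y\<close>. Each of the fewer than \<open>2 ^ n\<close>
  remaining terms decays at the contraction rate, and the normalisation \<open>2 ^ n\<close> cancels
  their number.\<close>

lemma xor_power_diff_le:
  assumes x: "x \<in> xor_profiles n" and y: "y \<in> xor_profiles n" and t: "t > 0"
  shows "\<bar>xor_power t x y - xor_stationary y\<bar> \<le> xor_rate ^ t"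
proof -
  define c where "c S = (\<Sum>z\<in>xor_profiles n. xor_power t x z * walsh S z)" for S
  define M where "M = Pow {..<n} - {{}, {..<n}}"
  have "2 ^ n * xor_power t x y = (\<Sum>z\<in>xor_profiles n. xor_power t x z * (2 ^ n * of_bool (z = y)))"
    using y finite_xor_profiles[of n] by (simp add: of_bool_def if_distrib cong: if_cong)
  also have "\<dots> = (\<Sum>z\<in>xor_profiles n. \<Sum>S\<in>Pow {..<n}. xor_power t x z * (walsh S z * walsh S y))"
    using y by (intro sum.cong refl) (simp add: sum_walsh_mult flip: sum_distrib_left)
  also have "\<dots> = (\<Sum>S\<in>Pow {..<n}. c S * walsh S y)"
    by (subst sum.swap) (simp add: c_def sum_distrib_right mult.assoc)
  also have "\<dots> = (\<Sum>S\<in>M. c S * walsh S y) + (\<Sum>S\<in>{{}, {..<n}}. c S * walsh S y)"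
    unfolding M_def by (rule sum.subset_diff) auto
  also have "(\<Sum>S\<in>{{}, {..<n}}. c S * walsh S y) = c {} * walsh {} y + c {..<n} * walsh {..<n} y"
  proof -
    \<comment> \<open>For \<open>n = 0\<close> the two exceptional sets would coincide and the sum
      would have one term only.\<close>
    have "{} \<noteq> {..<n}" using n by (simp add: lessThan_empty_iff eq_commute[of "{}"])
    then show ?thesis by simp
  qed
  also have "c {} * walsh {} y = 1"
    using matrix_power_sum_eq_1[of "xor_profiles n" xor_matrix, OF xor_matrix_row_sum finite_xor_profiles x]
    by (simp add: c_def walsh_def)
  also have "c {..<n} = drift"
    using t xor_power_walsh_full[OF x, of "t - 1"] by (simp add: c_def)
  finally have "2 ^ n * (xor_power t x y - xor_stationary y) = (\<Sum>S\<in>M. c S * walsh S y)"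
    using y by (simp add: xor_stationary_def right_diff_distrib)
  also have "\<bar>\<dots>\<bar> \<le> (\<Sum>S\<in>M. \<bar>c S * walsh S y\<bar>)"
    by (rule sum_abs)
  also have "\<dots> \<le> (\<Sum>S\<in>M. xor_rate ^ t)"
  proof (rule sum_mono)
    fix S assume "S \<in> M"
    then have "S \<subset> {..<n}" "S \<noteq> {}" by (auto simp: M_def)
    \<comment> \<open>The coefficients 1 and 0 single out the character of \<open>S\<close>.\<close>
    from xor_power_pair_bound[OF x this, of t 1 0]
    show "\<bar>c S * walsh S y\<bar> \<le> xor_rate ^ t"
      by (simp add: abs_mult abs_walsh c_def)
  qed
  also have "\<dots> \<le> (\<Sum>S\<in>Pow {..<n}. xor_rate ^ t)"
    using xor_rate_nonneg by (intro sum_mono2) (auto simp: M_def)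
  also have "\<dots> = 2 ^ n * xor_rate ^ t"
    by (simp add: card_Pow)
  finally show ?thesis
    by (simp add: abs_mult)
qed

lemma stationary_distribution_xor:
  "stationary_distribution (xor_profiles n) xor_matrix = xor_stationary"
proof (rule stationary_distribution_eqI[OF finite_xor_profiles xor_profiles_nonempty xor_matrix_row_sum])
  fix x y assume xy: "x \<in> xor_profiles n" "y \<in> xor_profiles n"
  have "(\<lambda>t. xor_power t x y - xor_stationary y) \<longlonglongrightarrow> 0"
  proof (rule tendsto_0_le[where K = 1])
    show "\<forall>\<^sub>F t in sequentially. norm (xor_power t x y - xor_stationary y) \<le> norm (xor_rate ^ t) * 1"
      \<comment> \<open>The pointwise bound is available only for \<open>t > 0\<close>.\<close>
      using eventually_gt_at_top[of 0]
      by eventually_elim (simp add: xor_power_diff_le xy xor_rate_nonneg)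
    show "(\<lambda>t. xor_rate ^ t) \<longlonglongrightarrow> 0"
      using xor_rate_nonneg xor_rate_less_1 by (intro LIMSEQ_power_zero) auto
  qed
  then show "(\<lambda>t. xor_power t x y) \<longlonglongrightarrow> xor_stationary y"
    by (rule LIM_zero_cancel)
next
  fix x
  show "0 \<le> xor_stationary x"
  proof -
    have "0 \<le> 1 + drift * walsh {..<n} x"
      using walsh_cases[of "{..<n}" x] drift_nonneg drift_less_1 by fastforce
    then show ?thesis by (simp add: xor_stationary_def)
  qed
next
  fix x assume "x \<notin> xor_profiles n"
  then show "xor_stationary x = 0" by (simp add: xor_stationary_def)
qed

section \<open>From the contraction rate to the mixing time\<close>

lemma xor_rate_power_le:
  assumes "real n * real (n + 2) * exp \<beta> \<le> real t"
  shows "2 ^ n * xor_rate ^ t \<le> 1 / 4"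
proof -
  have two: "2 \<le> exp (1::real)"
    using exp_ge_add_one_self[of 1] by simp
  have "xor_rate \<le> 1 - exp (- \<beta>) / n"
    using one_minus_drift_ge n by (simp add: xor_rate_def divide_simps)
  also have "\<dots> \<le> exp (- (exp (- \<beta>) / n))"
    using exp_ge_add_one_self[of "- (exp (- \<beta>) / n)"] by simp
  finally have "xor_rate ^ t \<le> exp (- (exp (- \<beta>) / n)) ^ t"
    using xor_rate_nonneg by (rule power_mono)
  also have "\<dots> = exp (- (real t * exp (- \<beta>) / n))"
    by (simp flip: exp_of_nat_mult)
  also have "\<dots> \<le> exp (- real (n + 2))"
  proof -
    have "real n * real (n + 2) \<le> real t * exp (- \<beta>)"
      using mult_right_mono[OF assms, of "exp (- \<beta>)"] by (simp add: mult.assoc flip: exp_add)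
    then have "real (n + 2) \<le> real t * exp (- \<beta>) / n"
      using n by (subst pos_le_divide_eq) (auto simp: mult.commute)
    then show ?thesis by simp
  qed
  finally have "2 ^ n * xor_rate ^ t \<le> 2 ^ n * exp (- real (n + 2))"
    by simp
  \<comment> \<open>The 2 in \<open>n + 2\<close> supplies the factor 1/4; the remaining power of 2
    is absorbed by the exponential because \<open>exp 1 \<ge> 2\<close>.\<close>
  also have "\<dots> = 2 ^ (n + 2) * exp (- real (n + 2)) / 4"
    by simp
  also have "2 ^ (n + 2) \<le> exp (1::real) ^ (n + 2)"
    using two by (rule power_mono) simp
  then have "2 ^ (n + 2) \<le> exp (real (n + 2))"
    by (simp only: exp_of_nat_mult[symmetric] mult_1_right)
  then have "2 ^ (n + 2) * exp (- real (n + 2)) / 4 \<le> 1 / 4"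
    using mult_right_mono[of "2 ^ (n + 2)" "exp (real (n + 2))" "exp (- real (n + 2))"]
    by (simp flip: exp_add)
  finally show ?thesis .
qed

lemma logit_mixing_time_xor_le:
  "real (logit_mixing_time n xor_strategies (xor_utility n) \<beta>) \<le> 4 * real n ^ 2 * exp \<beta>"
proof -
  define r where "r = real n * real (n + 2) * exp \<beta>"
  define t where "t = nat \<lceil>r\<rceil>"
  have r: "r > 0" using n by (simp add: r_def)
  have t: "r \<le> real t" "real t \<le> r + 1" "t > 0"
    using r unfolding t_def by linarith+
  have "mixing_time (xor_profiles n) xor_matrix \<le> t"
  proof (rule mixing_time_le[where e = "xor_rate ^ t"])
    show "real (card (xor_profiles n)) * xor_rate ^ t \<le> 1 / 4"
      using xor_rate_power_le[of t] t by (simp add: card_xor_profiles r_def)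
  qed (auto simp: finite_xor_profiles xor_profiles_nonempty stationary_distribution_xor
      xor_power_diff_le t)
  then have "real (logit_mixing_time n xor_strategies (xor_utility n) \<beta>) \<le> r + 1"
    using t unfolding logit_mixing_time_def by linarith
  \<comment> \<open>The 1 lost by rounding \<open>r\<close> up is absorbed using
    \<open>exp \<beta> \<ge> 1\<close>.\<close>
  also have "\<dots> \<le> (real n * real (n + 2) + 1) * exp \<beta>"
    using beta by (simp add: r_def distrib_right)
  also have "\<dots> \<le> (4 * real n ^ 2) * exp \<beta>"
  proof (rule mult_right_mono)
    \<comment> \<open>The left side is the square of \<open>n + 1\<close>, which is at most
      \<open>2 * n\<close>.\<close>
    have "n * (n + 2) + 1 \<le> 4 * n ^ 2"
      using n mult_le_mono1[OF n, of n] unfolding power2_eq_square distrib_left by linarith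
    then have "real (n * (n + 2) + 1) \<le> real (4 * n ^ 2)" by (rule of_nat_mono)
    then show "real n * real (n + 2) + 1 \<le> 4 * real n ^ 2"
      by (simp only: of_nat_add of_nat_mult of_nat_power of_nat_numeral of_nat_1)
  qed simp
  finally show ?thesis .
qed

end

theorem theorem24:
  "\<exists>K::real. K > 0 \<and>
     (\<forall>(n::nat) (\<beta>::real). n \<ge> 1 \<longrightarrow> \<beta> \<ge> 0 \<longrightarrow>
        real (logit_mixing_time n xor_strategies (xor_utility n) \<beta>) \<le> K * real n ^ 3 * exp \<beta>)"
proof (intro exI[of _ 4] conjI allI impI)
  fix n :: nat and \<beta> :: real
  assume n: "n \<ge> 1" and "\<beta> \<ge> 0"
  have "real (logit_mixing_time n xor_strategies (xor_utility n) \<beta>) \<le> 4 * real n ^ 2 * exp \<beta>"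
    by (rule logit_mixing_time_xor_le) fact+
  \<comment> \<open>The quadratic bound is stronger than the cubic one because
    \<open>n \<ge> 1\<close>; its constant 4 serves as \<open>K\<close>.\<close>
  also have "\<dots> \<le> 4 * real n ^ 3 * exp \<beta>"
    using n by (intro mult_right_mono mult_left_mono power_increasing) auto
  finally show "real (logit_mixing_time n xor_strategies (xor_utility n) \<beta>) \<le> 4 * real n ^ 3 * exp \<beta>" .
qed simp

end
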